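(* Let $R$ be a reduced commutative ring, let $n\in\mathbb{N}$, and let $A$ be a principled $n\times n$-matrix over $R$. Then $A$ is nullcyclic. Consequently, every power $A^m$ (with $m\in\mathbb{N}$) of $A$ is principled.
   Context: All rings are commutative, associative and unital; $\mathbb{N}=\{0,1,2,\ldots\}$ and $[n]:=\{1,2,\ldots,n\}$. Let $A=(a_{i,j})_{i,j\in[n]}$ be a matrix over $R$. For $S\subseteq[n]$, $A_S$ denotes the principal submatrix of $A$ with row and column set $S$; the empty determinant is $1$. $A$ is principled if $\det A_S=\prod_{i\in S}a_{i,i}$ for every $S\subseteq[n]$. A cycle on $[n]$ is a $k$-tuple $C=(i_1,i_2,\ldots,i_k)$ with $k>0$ and $i_1,\ldots,i_k$ distinct elements of $[n]$, considered up to cyclic rotation; it is nontrivial if $k>1$. The $A$-weight of a cycle $C=(i_1,\ldots,i_k)$ is $w_A(C):=a_{i_1,i_2}a_{i_2,i_3}\cdots a_{i_{k-1},i_k}a_{i_k,i_1}$. $A$ is nullcyclic if $w_A(C)=0$ for each nontrivial cycle $C$ on $[n]$. *)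

theory Defs
  imports
    "Jordan_Normal_Form.Determinant"
    "Jordan_Normal_Form.DL_Submatrix"
begin

definition reduced_ring :: "'a::comm_ring_1 itself \<Rightarrow> bool" where
  "reduced_ring _ \<longleftrightarrow> (\<forall>(x::'a) (k::nat). x ^ k = 0 \<longrightarrow> x = 0)"

text \<open>
  Rows and columns are indexed by 0, ..., n - 1. The predicates below are meant for square
  matrices, so the index set is read off from the number of rows.
\<close>

definition principled :: "'a::comm_ring_1 mat \<Rightarrow> bool" where
  "principled A \<longleftrightarrow>
     (\<forall>S \<subseteq> {0..<dim_row A}. det (submatrix A S S) = (\<Prod>i\<in>S. A $$ (i, i)))"

text \<open>
  A cycle is represented by any one of the tuples in its rotation class;
  \<open>cycle_weight_rotate\<close> below shows that the weight does not depend on the choice.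
\<close>

definition is_cycle :: "nat \<Rightarrow> nat list \<Rightarrow> bool" where
  "is_cycle n c \<longleftrightarrow> c \<noteq> [] \<and> distinct c \<and> set c \<subseteq> {0..<n}"

definition nontrivial_cycle :: "nat \<Rightarrow> nat list \<Rightarrow> bool" where
  "nontrivial_cycle n c \<longleftrightarrow> is_cycle n c \<and> length c > 1"

definition cycle_weight :: "'a::comm_ring_1 mat \<Rightarrow> nat list \<Rightarrow> 'a" where
  "cycle_weight A c = (\<Prod>k<length c. A $$ (c ! k, c ! (Suc k mod length c)))"

definition nullcyclic :: "'a::comm_ring_1 mat \<Rightarrow> bool" where
  "nullcyclic A \<longleftrightarrow> (\<forall>c. nontrivial_cycle (dim_row A) c \<longrightarrow> cycle_weight A c = 0)"

lemma cycle_weight_rotate: "cycle_weight A (rotate m c) = cycle_weight A c"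
proof -
  have *: "cycle_weight A (rotate1 d) = cycle_weight A d" for d
  proof (cases d)
    case (Cons x xs)
    let ?f = "\<lambda>k. A $$ (d ! k, d ! (Suc k mod length d))"
    let ?n = "length xs"
    have len: "length d = Suc ?n" using Cons by simp
    have "cycle_weight A (rotate1 d) = (\<Prod>k<Suc ?n. ?f (Suc k mod Suc ?n))"
      unfolding cycle_weight_def length_rotate1 len
    proof (rule prod.cong[OF refl])
      fix k assume "k \<in> {..<Suc ?n}"
      then have "k < length d" "Suc k mod Suc ?n < length d" by (simp_all add: len)
      then show "A $$ (rotate1 d ! k, rotate1 d ! (Suc k mod Suc ?n)) =
          A $$ (d ! (Suc k mod Suc ?n), d ! (Suc (Suc k mod Suc ?n) mod Suc ?n))"
        by (simp only: nth_rotate1 len)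
    qed
    also have "\<dots> = (\<Prod>k<?n. ?f (Suc k)) * ?f 0" by simp
    also have "\<dots> = (\<Prod>k<Suc ?n. ?f k)"
      by (simp only: prod.lessThan_Suc_shift mult.commute)
    finally show ?thesis by (simp only: cycle_weight_def len)
  qed simp
  show ?thesis by (induction m) (simp_all add: *)
qed

end

theory Submission
  imports Defs "HOL-Combinatorics.Cycles"
begin

text \<open>
  \<^bold>\<open>Principled implies nullcyclic.\<close> Induct on the length \<open>k\<close> of a nontrivial cycle \<open>c\<close>, and
  replace \<open>A\<close> by its principal submatrix \<open>B\<close> on the vertices of \<open>c\<close>, so that \<open>c\<close> runs through
  all \<open>k\<close> indices and every shorter nontrivial cycle of \<open>B\<close> has weight \<open>0\<close>. In the Leibniz expansion
  of \<open>det B\<close>, the identity contributes the product of the diagonal, which is all of \<open>det B\<close> by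
  hypothesis, and the permutation that rotates \<open>c\<close> contributes \<open>w(c)\<close> up to sign. Now multiply the
  expansion by \<open>w(c)\<close>. This kills every other permutation \<open>q\<close>
  (lemma \<open>cycle_weight_mult_perm_prod\<close>): either \<open>q\<close> has a fixed point, and then one of its nontrivial
  cycles is shorter than \<open>k\<close>; or \<open>q\<close> has an arc \<open>i \<rightarrow> j\<close> which is not a loop and not in \<open>c\<close>, and this
  arc together with the path from \<open>j\<close> to \<open>i\<close> along \<open>c\<close> is a cycle shorter than \<open>k\<close>.
  What remains says \<open>w(c)\<^sup>2 = 0\<close>, hence \<open>w(c) = 0\<close> because the ring is reduced.

  \<^bold>\<open>Powers.\<close> In a nullcyclic matrix every closed walk through at least two vertices has weight \<open>0\<close>: it
  splits at repeated vertices until a nontrivial cycle appears. A cycle weight of \<open>A\<^sup>m\<close> is a sum of weights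
  of such closed walks of \<open>A\<close>, so \<open>A\<^sup>m\<close> is nullcyclic. Finally a nullcyclic matrix is principled over any
  commutative ring, since in the Leibniz expansion of each principal minor only the identity survives.
\<close>

section \<open>Walks and cycles\<close>

fun walk_weight :: "'a::comm_ring_1 mat \<Rightarrow> nat list \<Rightarrow> 'a" where
  "walk_weight A (i # j # xs) = A $$ (i, j) * walk_weight A (j # xs)"
| "walk_weight A _ = 1"

lemma walk_weight_append:
  "walk_weight A (xs @ v # ys) = walk_weight A (xs @ [v]) * walk_weight A (v # ys)"
  by (induction A xs rule: walk_weight.induct) (simp_all add: mult.assoc)

lemma walk_weight_nth:
  "walk_weight A xs = (\<Prod>k<length xs - 1. A $$ (xs ! k, xs ! Suc k))"
  by (induction A xs rule: walk_weight.induct) (simp_all add: prod.lessThan_Suc_shift del: prod.lessThan_Suc)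

lemma cycle_weight_Cons: "cycle_weight A (x # xs) = walk_weight A (x # xs @ [x])"
proof -
  have "A $$ ((x # xs) ! k, (x # xs) ! (Suc k mod length (x # xs)))
      = A $$ ((x # xs @ [x]) ! k, (x # xs @ [x]) ! Suc k)" if "k < Suc (length xs)" for k
    using that by (cases "k = length xs") (auto simp: nth_append nth_Cons split: nat.split)
  then show ?thesis
    unfolding cycle_weight_def walk_weight_nth by (intro prod.cong) auto
qed

text \<open>A closed walk that returns to \<open>v\<close> half-way consists of two closed walks at \<open>v\<close>.\<close>

lemma cycle_weight_split:
  "cycle_weight A (v # xs @ v # ys) = cycle_weight A (v # xs) * cycle_weight A (v # ys)"
  using walk_weight_append[of A "v # xs" v "ys @ [v]"] by (simp add: cycle_weight_Cons)

text \<open>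
  This finds cycle weights inside the Leibniz formula: the right-hand side is the part over \<open>set c\<close>
  of the term of a permutation \<open>f\<close> that sends each entry of \<open>c\<close> to its cyclic successor.
\<close>

lemma cycle_weight_conv_prod:
  assumes "distinct c" "map f c = rotate1 c"
  shows "cycle_weight A c = (\<Prod>i\<in>set c. A $$ (i, f i))"
proof -
  have "f (c ! k) = c ! (Suc k mod length c)" if "k < length c" for k
    using that assms(2) nth_rotate1[OF that] by (metis nth_map)
  then have "cycle_weight A c = (\<Prod>k<length c. A $$ (c ! k, f (c ! k)))"
    by (simp add: cycle_weight_def)
  also have "\<dots> = (\<Prod>i\<in>set c. A $$ (i, f i))"
    by (rule prod.reindex_bij_betw) (simp add: bij_betw_nth assms(1))
  finally show ?thesis .
qed

text \<open>
  The list \<open>c\<close> may have repetitions, so \<open>cycle_weight\<close> is here the weight of an arbitrary closed walk.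
  If a vertex repeats, the walk splits there into two shorter closed walks, one of which still meets
  two different vertices; otherwise the walk is itself a nontrivial cycle.
\<close>

lemma nullcyclic_closed_walk:
  assumes "nullcyclic A" "set c \<subseteq> {0..<dim_row A}" "x \<in> set c" "y \<in> set c" "x \<noteq> y"
  shows "cycle_weight A c = 0"
  using assms(2-)
proof (induction "length c" arbitrary: c x y rule: less_induct)
  case less
  show ?case
  proof (cases "distinct c")
    case True
    have "length c > 1"
      using less.prems by (cases c; cases "tl c") auto
    with True less.prems have "nontrivial_cycle (dim_row A) c"
      by (auto simp: nontrivial_cycle_def is_cycle_def)
    with assms(1) show ?thesis by (simp add: nullcyclic_def)
  next
    case False
    then obtain xs v ys zs where c: "c = xs @ [v] @ ys @ [v] @ zs"
      using not_distinct_decomp by blast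
    have "cycle_weight A c = cycle_weight A (v # ys @ v # zs @ xs)"
      using cycle_weight_rotate[of A "length xs" c] by (simp add: c rotate_append)
    also have "\<dots> = cycle_weight A (v # ys) * cycle_weight A (v # zs @ xs)"
      by (rule cycle_weight_split)
    also have "\<dots> = 0"
    proof -
      obtain u where u: "u \<in> set c" "u \<noteq> v" using less.prems by metis
      then consider "u \<in> set ys" | "u \<in> set (zs @ xs)" by (auto simp: c)
      then show ?thesis
      proof cases
        case 1
        then have "cycle_weight A (v # ys) = 0"
          using u less.prems(1) by (intro less.hyps[of _ u v]) (auto simp: c)
        then show ?thesis by simp
      next
        case 2
        then have "cycle_weight A (v # zs @ xs) = 0"
          using u less.prems(1) by (intro less.hyps[of _ u v]) (auto simp: c)
        then show ?thesis by simp
      qed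
    qed
    finally show ?thesis .
  qed
qed

section \<open>Powers of nullcyclic matrices\<close>

definition walks :: "nat \<Rightarrow> nat \<Rightarrow> nat \<Rightarrow> nat list set" where
  "walks n i j = {w. w \<noteq> [] \<and> hd w = i \<and> last w = j \<and> set w \<subseteq> {0..<n}}"

lemma walks_snocE:
  assumes "w \<in> walks n i j"
  obtains w' where "w = w' @ [j]"
  using assms by (cases w rule: rev_cases) (auto simp: walks_def)

text \<open>
  An entry of \<open>A\<^sup>m\<close> is a sum of weights of walks with \<open>m\<close> steps. This is used only to show that products
  vanish, hence the form: a factor \<open>z\<close> that kills all these weights kills the
  entry. The induction then carries one arbitrary \<open>z\<close> instead of a sum indexed by lists.
\<close>

lemma pow_entry_annihilated:
  assumes A: "A \<in> carrier_mat n n" and ij: "i < n" "j < n"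
    and "\<And>w. w \<in> walks n i j \<Longrightarrow> walk_weight A w * z = 0"
  shows "(A ^\<^sub>m m) $$ (i, j) * z = 0"
  using ij(2) assms(4)
proof (induction m arbitrary: j z)
  case 0
  show ?case
  proof (cases "i = j")
    case True
    with 0(2)[of "[i]"] ij show ?thesis using A by (auto simp: walks_def)
  qed (use 0 ij A in auto)
next
  case (Suc m)
  have "(A ^\<^sub>m m) $$ (i, k) * (A $$ (k, j) * z) = 0" if k: "k < n" for k
  proof (rule Suc.IH[OF k])
    fix w assume w: "w \<in> walks n i k"
    then obtain w' where w': "w = w' @ [k]" by (rule walks_snocE)
    have "walk_weight A (w @ [j]) * z = 0"
      using w Suc.prems(1) by (intro Suc.prems(2)) (auto simp: walks_def)
    then show "walk_weight A w * (A $$ (k, j) * z) = 0"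
      using walk_weight_append[of A w' k "[j]"] by (simp add: w' mult.assoc)
  qed
  then have "(\<Sum>k = 0..<n. (A ^\<^sub>m m) $$ (i, k) * A $$ (k, j)) * z = 0"
    by (simp add: sum_distrib_right mult.assoc)
  moreover have "(A ^\<^sub>m Suc m) $$ (i, j) = (\<Sum>k = 0..<n. (A ^\<^sub>m m) $$ (i, k) * A $$ (k, j))"
    using A ij Suc.prems(1) by (auto simp: scalar_prod_def)
  ultimately show ?case by (simp only:)
qed

text \<open>
  Replacing each step of a walk \<open>d\<close> of \<open>A\<^sup>m\<close> by a walk of \<open>A\<close> gives a walk of \<open>A\<close> that
  still visits all vertices of \<open>d\<close>. The induction peels off the first step and moves its
  weight into \<open>z\<close>.
\<close>

lemma pow_walk_annihilated:
  assumes A: "A \<in> carrier_mat n n"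
    and "d \<noteq> []" "set d \<subseteq> {0..<n}"
    and "\<And>w. w \<in> walks n (hd d) (last d) \<Longrightarrow> set d \<subseteq> set w \<Longrightarrow> walk_weight A w * z = 0"
  shows "walk_weight (A ^\<^sub>m m) d * z = 0"
  using assms(2-)
proof (induction "A ^\<^sub>m m" d arbitrary: z rule: walk_weight.induct)
  case (1 x y d)
  have "(A ^\<^sub>m m) $$ (x, y) * (walk_weight (A ^\<^sub>m m) (y # d) * z) = 0"
  proof (rule pow_entry_annihilated[OF A])
    fix e assume e: "e \<in> walks n x y"
    then obtain e' where e': "e = e' @ [y]" by (rule walks_snocE)
    have "walk_weight (A ^\<^sub>m m) (y # d) * (walk_weight A e * z) = 0"
    proof (rule "1.hyps")
      fix w assume w: "w \<in> walks n (hd (y # d)) (last (y # d))" "set (y # d) \<subseteq> set w"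
      then obtain w' where w': "w = y # w'"
        by (cases w) (auto simp: walks_def)
      have "walk_weight A (e' @ y # w') * z = 0"
      proof (rule "1.prems"(3))
        show "e' @ y # w' \<in> walks n (hd (x # y # d)) (last (x # y # d))"
          using e w unfolding e' w' by (cases e') (auto simp: walks_def)
        show "set (x # y # d) \<subseteq> set (e' @ y # w')"
          using e w unfolding e' w' by (cases e') (auto simp: walks_def)
      qed
      then show "walk_weight A w * (walk_weight A e * z) = 0"
        unfolding walk_weight_append[of A e' y w'] by (simp add: e' w' ac_simps)
    qed (use "1.prems" in auto)
    then show "walk_weight A e * (walk_weight (A ^\<^sub>m m) (y # d) * z) = 0"
      by (simp only: ac_simps)
  qed (use "1.prems" in auto)
  then show ?case by (simp add: mult.assoc)
next
  case ("2_2" v)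
  from "2_2"(3)[of "[v]"] "2_2"(2) show ?case by (simp add: walks_def)
qed simp

lemma nullcyclic_pow:
  assumes A: "A \<in> carrier_mat n n" and null: "nullcyclic A"
  shows "nullcyclic (A ^\<^sub>m m)"
  unfolding nullcyclic_def
proof (intro allI impI)
  fix c assume "nontrivial_cycle (dim_row (A ^\<^sub>m m)) c"
  then have c: "distinct c" "length c > 1" "set c \<subseteq> {0..<n}"
    using A by (auto simp: nontrivial_cycle_def is_cycle_def)
  then obtain x y d where d: "c = x # y # d"
    by (cases c; cases "tl c") auto
  \<comment> \<open>close up the cycle to a walk from \<open>x\<close> to \<open>x\<close>; it is the second vertex \<open>y\<close> that
      makes every refinement of it vanish\<close>
  have "walk_weight (A ^\<^sub>m m) (c @ [x]) * 1 = 0"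
  proof (rule pow_walk_annihilated[OF A])
    fix w assume w: "w \<in> walks n (hd (c @ [x])) (last (c @ [x]))" "set (c @ [x]) \<subseteq> set w"
    then obtain w' where w': "w = x # w'" by (cases w) (auto simp: walks_def d)
    moreover have "w' \<noteq> []" using w c by (auto simp: w' d)
    ultimately obtain w'' where w'': "w = x # w'' @ [x]"
      using w by (cases w' rule: rev_cases) (auto simp: walks_def d)
    have "cycle_weight A (x # w'') = 0"
      by (rule nullcyclic_closed_walk[OF null, of _ x y])
         (use w c A in \<open>auto simp: w'' d walks_def\<close>)
    then show "walk_weight A w * 1 = 0" by (simp add: cycle_weight_Cons w'')
  qed (use c d in auto)
  then show "cycle_weight (A ^\<^sub>m m) c = 0" by (simp add: d cycle_weight_Cons)
qed

section \<open>Cycles and the Leibniz formula\<close>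

text \<open>The cycle is the orbit of \<open>x\<close> under \<open>q\<close>.\<close>

lemma moved_point_cycle:
  assumes q: "q permutes {0..<n}" and x: "q x \<noteq> x"
  obtains d where "nontrivial_cycle n d" "map q d = rotate1 d" "\<And>i. i \<in> set d \<Longrightarrow> q i \<noteq> i"
proof
  have perm: "permutation q" using q by (auto simp: permutation_permutes)
  let ?d = "support q x"
  have moved: "q i \<noteq> i" if i: "i \<in> set ?d" for i
  proof -
    from i obtain t where "i = (q ^^ t) x" by auto
    moreover have "(q ^^ t) (q x) \<noteq> (q ^^ t) x"
      using x q by (metis permutes_inj inj_fn injD)
    ultimately show ?thesis by (metis funpow_swap1)
  qed
  then show "\<And>i. i \<in> set ?d \<Longrightarrow> q i \<noteq> i" .
  have "set ?d \<subseteq> {0..<n}"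
  proof
    fix i assume "i \<in> set ?d"
    then have "q i \<noteq> i" by (rule moved)
    with permutes_not_in[OF q] show "i \<in> {0..<n}" by blast
  qed
  then show "nontrivial_cycle n ?d"
    using least_power_gt_one[of q x, OF perm x] cycle_of_permutation[of q x, OF perm]
    by (auto simp: nontrivial_cycle_def is_cycle_def)
  show "map q ?d = rotate1 ?d"
  proof (rule nth_equalityI)
    fix i assume "i < length (map q ?d)"
    then have i: "i < least_power q x" by simp
    show "map q ?d ! i = rotate1 ?d ! i"
    proof (cases "Suc i = least_power q x")
      case True
      then have "q ((q ^^ i) x) = x"
        using least_power_of_permutation(1)[OF perm, of x] by (metis comp_apply funpow.simps(2))
      with True i show ?thesis by (simp add: nth_rotate1)
    qed (use i in \<open>simp add: nth_rotate1\<close>)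
  qed simp
qed

lemma cycle_weight_dvd_perm_prod:
  assumes "nontrivial_cycle n d" "map q d = rotate1 d"
  shows "cycle_weight B d dvd (\<Prod>i = 0..<n. B $$ (i, q i))"
  using assms cycle_weight_conv_prod[of d q B]
  by (auto simp: nontrivial_cycle_def is_cycle_def intro: prod_dvd_prod_subset)

lemma det_nullcyclic:
  assumes B: "B \<in> carrier_mat n n" and null: "nullcyclic B"
  shows "det B = (\<Prod>i = 0..<n. B $$ (i, i))"
proof -
  have zero: "(\<Prod>i = 0..<n. B $$ (i, q i)) = 0" if q: "q permutes {0..<n}" "q \<noteq> id" for q
  proof -
    from q(2) obtain x where "q x \<noteq> x" by (auto simp: fun_eq_iff)
    from moved_point_cycle[OF q(1) this] obtain d
      where d: "nontrivial_cycle n d" "map q d = rotate1 d" by metis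
    moreover have "cycle_weight B d = 0" using d B null by (auto simp: nullcyclic_def)
    ultimately show ?thesis using cycle_weight_dvd_perm_prod[of n d q B] by simp
  qed
  have "det B = (\<Sum>q\<in>{q. q permutes {0..<n}}. signof q * (\<Prod>i = 0..<n. B $$ (i, q i)))"
    by (rule det_def'[OF B])
  also have "\<dots> = (\<Sum>q\<in>{id}. signof q * (\<Prod>i = 0..<n. B $$ (i, q i)))"
    by (rule sum.mono_neutral_right)
       (use zero in \<open>auto simp: permutes_id finite_permutations simp del: mult_eq_0_iff\<close>)
  finally show ?thesis by simp
qed

text \<open>
  The combinatorial heart: superposing on the full cycle \<open>c\<close> the arcs of a permutation \<open>q\<close> that is
  neither the identity nor the rotation along \<open>c\<close> always creates a nontrivial cycle
  shorter than \<open>n\<close>, whose weight divides the product.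
\<close>

lemma cycle_weight_mult_perm_prod:
  assumes shorter: "\<And>d. nontrivial_cycle n d \<Longrightarrow> length d < n \<Longrightarrow> cycle_weight B d = 0"
    and c: "distinct c" "set c = {0..<n}"
    and q: "q permutes {0..<n}" "q \<noteq> id" "map q c \<noteq> rotate1 c"
  shows "cycle_weight B c * (\<Prod>i = 0..<n. B $$ (i, q i)) = 0"
proof (cases "\<exists>y<n. q y = y")
  case True
  then obtain y where y: "y < n" "q y = y" by blast
  from q(2) obtain x where "q x \<noteq> x" by (auto simp: fun_eq_iff)
  from moved_point_cycle[OF q(1) this] obtain d
    where d: "nontrivial_cycle n d" "map q d = rotate1 d" "\<And>i. i \<in> set d \<Longrightarrow> q i \<noteq> i" by metis
  have "set d \<subset> {0..<n}"
    using d y by (auto simp: nontrivial_cycle_def is_cycle_def)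
  then have "card (set d) < card {0..<n}" by (intro psubset_card_mono) auto
  then have "length d < n"
    using d(1) by (simp add: nontrivial_cycle_def is_cycle_def distinct_card)
  with shorter d(1) cycle_weight_dvd_perm_prod[OF d(1,2), of B] show ?thesis by simp
next
  case False
  have len: "length c = n" using c distinct_card by fastforce
  from q(3) obtain k where k: "k < n" "q (c ! k) \<noteq> c ! (Suc k mod n)"
    by (auto simp: list_eq_iff_nth_eq len nth_rotate1)
  define i j where "i = c ! k" and "j = q i"
  have i: "i < n" using k c len nth_mem[of k c] by (auto simp: i_def)
  then have j: "j < n" using q(1) permutes_in_image[of q "{0..<n}" i] by (auto simp: j_def)
  have "j \<noteq> i" using False i j_def by auto
  \<comment> \<open>cut \<open>c\<close> open behind \<open>i\<close>: as \<open>j\<close> is not the successor of \<open>i\<close>, it is not at the head of \<open>r\<close>,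
      so the piece of \<open>r\<close> from \<open>j\<close> to \<open>i\<close> is a proper part of \<open>c\<close>\<close>
  define r where "r = rotate (Suc k) c"
  have r: "distinct r" "set r = {0..<n}" "length r = n" "cycle_weight B r = cycle_weight B c"
    using c len by (simp_all add: r_def cycle_weight_rotate del: rotate_Suc)
  have "r \<noteq> []" using r(3) i by auto
  have hd_r: "hd r = c ! (Suc k mod n)"
    using i len by (cases "c = []") (simp_all add: r_def hd_rotate_conv_nth del: rotate_Suc)
  have last_r: "last r = i"
    using i k len \<open>r \<noteq> []\<close> r(3) by (simp add: last_conv_nth r_def nth_rotate i_def del: rotate_Suc)
  from j r obtain P Q where PQ: "r = P @ j # Q" by (metis atLeastLessThan_iff le0 split_list)
  have "P \<noteq> []" using hd_r k(2) PQ by (auto simp: j_def i_def)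
  obtain ys where ys: "Q = ys @ [i]"
    using last_r PQ \<open>j \<noteq> i\<close> by (cases Q rule: rev_cases) auto
  let ?d = "j # ys @ [i]"
  have "cycle_weight B ?d = 0"
  proof (rule shorter)
    show "nontrivial_cycle n ?d"
      using r(1,2) unfolding PQ ys nontrivial_cycle_def is_cycle_def by auto
    show "length ?d < n"
      using \<open>P \<noteq> []\<close> r(3) by (cases P) (simp_all add: PQ ys)
  qed
  then have short: "walk_weight B ?d * B $$ (i, j) = 0"
    using walk_weight_append[of B "j # ys" i "[j]"] by (simp add: cycle_weight_Cons)
  have "cycle_weight B c = cycle_weight B (rotate (length P) r)"
    by (simp add: r(4) cycle_weight_rotate)
  also have "rotate (length P) r = j # ys @ i # P"
    by (simp add: PQ ys rotate_append)
  also have "cycle_weight B (j # ys @ i # P) = walk_weight B ?d * walk_weight B (i # P @ [j])"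
    using walk_weight_append[of B "j # ys" i "P @ [j]"] by (simp add: cycle_weight_Cons)
  finally have "walk_weight B ?d dvd cycle_weight B c" by simp
  moreover have "B $$ (i, j) dvd (\<Prod>i = 0..<n. B $$ (i, q i))"
    unfolding j_def using i by (intro dvd_prodI) auto
  ultimately have "walk_weight B ?d * B $$ (i, j) dvd cycle_weight B c * (\<Prod>i = 0..<n. B $$ (i, q i))"
    by (rule mult_dvd_mono)
  then show ?thesis by (simp add: short)
qed

text \<open>
  Multiplying the Leibniz formula by \<open>w(c)\<close> leaves only the identity and the rotation
  along \<open>c\<close>. The former cancels against \<open>det B\<close>, the latter gives \<open>w(c)\<^sup>2\<close> up to sign.
\<close>

lemma full_cycle_weight_zero:
  fixes B :: "'a::comm_ring_1 mat"
  assumes red: "reduced_ring TYPE('a)"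
    and B: "B \<in> carrier_mat n n" "det B = (\<Prod>i = 0..<n. B $$ (i, i))"
    and shorter: "\<And>d. nontrivial_cycle n d \<Longrightarrow> length d < n \<Longrightarrow> cycle_weight B d = 0"
    and c: "distinct c" "set c = {0..<n}" "length c > 1"
  shows "cycle_weight B c = 0"
proof -
  define p where "p = cycle_of_list c"
  let ?w = "cycle_weight B c"
  let ?f = "\<lambda>q. signof q * (\<Prod>i = 0..<n. B $$ (i, q i))"
  have p: "p permutes {0..<n}" using cycle_permutes[of c] c by (simp add: p_def)
  have rot: "map p c = rotate1 c" using cyclic_rotation[OF c(1), of 1] by (simp add: p_def)
  have "p \<noteq> id"
  proof
    assume "p = id"
    with rot have "rotate1 c = c" by simp
    moreover have "rotate1 c ! 0 = c ! (Suc 0 mod length c)"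
      using c(3) by (intro nth_rotate1) linarith
    ultimately have "c ! 0 = c ! 1" using c(3) by simp
    moreover have "c ! 0 \<noteq> c ! 1"
      using c(3) by (subst nth_eq_iff_index_eq[OF c(1)]) auto
    ultimately show False by simp
  qed
  have other: "?w * ?f q = 0" if q: "q permutes {0..<n}" "q \<noteq> id" "q \<noteq> p" for q
  proof -
    have "map q c \<noteq> rotate1 c"
    proof
      assume "map q c = rotate1 c"
      then have "q x = p x" for x
        using rot c(2) q(1) p by (cases "x \<in> set c") (metis map_eq_conv, metis permutes_not_in)
      with q(3) show False by auto
    qed
    then have "?w * (\<Prod>i = 0..<n. B $$ (i, q i)) = 0"
      using cycle_weight_mult_perm_prod[OF shorter c(1,2) q(1,2)] by blast
    then show ?thesis by (metis mult.left_commute mult_zero_right)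
  qed
  have "?w * det B = (\<Sum>q\<in>{q. q permutes {0..<n}}. ?w * ?f q)"
    by (simp add: det_def'[OF B(1)] sum_distrib_left)
  also have "\<dots> = (\<Sum>q\<in>{id, p}. ?w * ?f q)"
    by (rule sum.mono_neutral_right)
       (use other p in \<open>auto simp: permutes_id finite_permutations simp del: mult_eq_0_iff\<close>)
  also have "\<dots> = ?w * det B + ?w * ?f p"
    using \<open>p \<noteq> id\<close> by (simp add: B(2))
  finally have "?w * ?f p = 0" by simp
  moreover have "(\<Prod>i = 0..<n. B $$ (i, p i)) = ?w"
    using cycle_weight_conv_prod[OF c(1) rot, of B] c(2) by simp
  ultimately have "?w ^ 2 = 0"
    by (simp add: power2_eq_square sign_def split: if_splits)
  with red show ?thesis unfolding reduced_ring_def by blast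
qed

section \<open>Principal submatrices\<close>

lemma bij_betw_pick: "finite S \<Longrightarrow> bij_betw (pick S) {0..<card S} S"
proof -
  assume S: "finite S"
  have inj: "inj_on (pick S) {0..<card S}"
    by (rule linorder_inj_onI) (auto dest: pick_mono_le)
  have "pick S ` {0..<card S} \<subseteq> S" by (auto intro: pick_in_set_le)
  with S inj show ?thesis
    unfolding bij_betw_def by (metis card_atLeastLessThan card_image card_subset_eq diff_zero)
qed

context
  fixes A :: "'a::comm_ring_1 mat" and n S
  assumes A: "A \<in> carrier_mat n n" and S: "S \<subseteq> {0..<n}"
begin

lemma principal_submatrix_carrier: "submatrix A S S \<in> carrier_mat (card S) (card S)"
proof -
  have "{i. i < dim_row A \<and> i \<in> S} = S" "{i. i < dim_col A \<and> i \<in> S} = S"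
    using S A by auto
  then show ?thesis by (intro carrier_matI) (simp_all only: dim_submatrix)
qed

lemma principal_submatrix_index:
  "i < card S \<Longrightarrow> j < card S \<Longrightarrow> submatrix A S S $$ (i, j) = A $$ (pick S i, pick S j)"
  using principal_submatrix_carrier submatrix_index[of i A S j S]
  unfolding carrier_mat_def mem_Collect_eq dim_submatrix by simp

lemma bij_betw_pick_principal: "bij_betw (pick S) {0..<card S} S"
  using S by (intro bij_betw_pick) (rule finite_subset, auto)

lemma prod_diag_principal_submatrix:
  "(\<Prod>i = 0..<card S. submatrix A S S $$ (i, i)) = (\<Prod>i\<in>S. A $$ (i, i))"
proof -
  have "(\<Prod>i = 0..<card S. submatrix A S S $$ (i, i)) = (\<Prod>i = 0..<card S. A $$ (pick S i, pick S i))"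
    by (intro prod.cong) (auto simp: principal_submatrix_index)
  also have "\<dots> = (\<Prod>i\<in>S. A $$ (i, i))"
    by (rule prod.reindex_bij_betw[OF bij_betw_pick_principal])
  finally show ?thesis .
qed

lemma nontrivial_cycle_map_pick:
  assumes "nontrivial_cycle (card S) c"
  shows "nontrivial_cycle n (map (pick S) c)"
proof -
  have "inj_on (pick S) (set c)" "pick S ` set c \<subseteq> S"
    using bij_betw_pick_principal assms
    by (auto simp: nontrivial_cycle_def is_cycle_def bij_betw_def intro: inj_on_subset)
  with assms S show ?thesis
    by (auto simp: nontrivial_cycle_def is_cycle_def distinct_map)
qed

lemma cycle_weight_principal_submatrix:
  assumes "set c \<subseteq> {0..<card S}"
  shows "cycle_weight (submatrix A S S) c = cycle_weight A (map (pick S) c)"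
  unfolding cycle_weight_def
proof (rule prod.cong)
  fix k assume "k \<in> {..<length (map (pick S) c)}"
  then have k: "k < length c" "Suc k mod length c < length c" by (auto intro: mod_less_divisor)
  then have "c ! k < card S" "c ! (Suc k mod length c) < card S"
    using assms by (meson atLeastLessThan_iff nth_mem subsetD)+
  with k show "submatrix A S S $$ (c ! k, c ! (Suc k mod length c)) =
      A $$ (map (pick S) c ! k, map (pick S) c ! (Suc k mod length (map (pick S) c)))"
    by (simp add: principal_submatrix_index)
qed simp

lemma nullcyclic_principal_submatrix:
  assumes "nullcyclic A"
  shows "nullcyclic (submatrix A S S)"
  unfolding nullcyclic_def
proof (intro allI impI)
  fix c assume "nontrivial_cycle (dim_row (submatrix A S S)) c"
  then have c: "nontrivial_cycle (card S) c" using principal_submatrix_carrier by simp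
  then have "cycle_weight (submatrix A S S) c = cycle_weight A (map (pick S) c)"
    by (intro cycle_weight_principal_submatrix) (simp add: nontrivial_cycle_def is_cycle_def)
  also have "\<dots> = 0"
    using assms nontrivial_cycle_map_pick[OF c] A by (simp add: nullcyclic_def)
  finally show "cycle_weight (submatrix A S S) c = 0" .
qed

end

section \<open>Principled and nullcyclic matrices\<close>

lemma nullcyclic_imp_principled:
  assumes A: "A \<in> carrier_mat n n" and null: "nullcyclic A"
  shows "principled A"
  unfolding principled_def
proof (intro allI impI)
  fix S assume "S \<subseteq> {0..<dim_row A}"
  with A have S: "S \<subseteq> {0..<n}" by simp
  show "det (submatrix A S S) = (\<Prod>i\<in>S. A $$ (i, i))"
    using det_nullcyclic[OF principal_submatrix_carrier[OF A S]
        nullcyclic_principal_submatrix[OF A S null]]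
    by (simp add: prod_diag_principal_submatrix[OF A S])
qed

lemma principled_imp_nullcyclic:
  fixes A :: "'a::comm_ring_1 mat"
  assumes red: "reduced_ring TYPE('a)"
    and A: "A \<in> carrier_mat n n" and princ: "principled A"
  shows "nullcyclic A"
proof -
  have "cycle_weight A c = 0" if "nontrivial_cycle n c" for c
    using that
  proof (induction "length c" arbitrary: c rule: less_induct)
    case less
    define S where "S = set c"
    have S: "S \<subseteq> {0..<n}" and c: "distinct c" "length c > 1"
      using less.prems by (auto simp: S_def nontrivial_cycle_def is_cycle_def)
    have card: "card S = length c" using c by (simp add: S_def distinct_card)
    let ?B = "submatrix A S S"
    note bij = bij_betw_pick_principal[OF A S]
    \<comment> \<open>\<open>c\<close> in the coordinates of \<open>?B\<close>, where it runs through all indices\<close>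
    define e where "e = map (inv_into {0..<card S} (pick S)) c"
    have set_e: "set e = {0..<card S}"
      using bij_betw_inv_into[OF bij] by (simp add: e_def S_def bij_betw_def)
    have "distinct e"
      using c(1) bij_betw_inv_into[OF bij] by (simp add: e_def S_def bij_betw_def distinct_map)
    have map_e: "map (pick S) e = c"
      using bij by (auto simp: e_def S_def o_def bij_betw_inv_into_right intro!: map_idI)
    have "cycle_weight ?B e = 0"
    proof (rule full_cycle_weight_zero[OF red principal_submatrix_carrier[OF A S]])
      show "det ?B = (\<Prod>i = 0..<card S. ?B $$ (i, i))"
        using princ A S by (simp add: principled_def prod_diag_principal_submatrix[OF A S])
      show "distinct e" "set e = {0..<card S}" "length e > 1"
        using \<open>distinct e\<close> set_e c by (simp_all add: e_def)
      fix d assume d: "nontrivial_cycle (card S) d" "length d < card S"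
      then have "cycle_weight ?B d = cycle_weight A (map (pick S) d)"
        by (intro cycle_weight_principal_submatrix[OF A S])
           (simp add: nontrivial_cycle_def is_cycle_def)
      also have "\<dots> = 0"
        using d card by (intro less.hyps nontrivial_cycle_map_pick[OF A S]) auto
      finally show "cycle_weight ?B d = 0" .
    qed
    moreover have "cycle_weight ?B e = cycle_weight A (map (pick S) e)"
      using set_e by (intro cycle_weight_principal_submatrix[OF A S]) simp
    ultimately show ?case by (simp add: map_e)
  qed
  with A show ?thesis by (simp add: nullcyclic_def)
qed

theorem corollary4p9:
  fixes n :: nat and A :: "'a::comm_ring_1 mat"
  assumes "reduced_ring TYPE('a)"
    and "A \<in> carrier_mat n n"
    and "principled A"
  shows "nullcyclic A \<and> (\<forall>m::nat. principled (A ^\<^sub>m m))"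
proof (intro conjI allI)
  show null: "nullcyclic A"
    by (rule principled_imp_nullcyclic[OF assms])
  show "principled (A ^\<^sub>m m)" for m
    using nullcyclic_pow[OF assms(2) null] assms(2)
    by (intro nullcyclic_imp_principled[of _ n]) auto
qed

end
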